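(* We have $$\bigcap_{d\in D}P_{\mathrm{MTZ}}(d)=\bigcap_{d\in V_{\mathrm{MTZ}}}P_{\mathrm{MTZ}}(d)=\overline P_{\mathrm{MTZ}},$$ where $$\overline P_{\mathrm{MTZ}} = \Big\{x\in P_{\mathrm{AP}} : \sum_{ij\in C}x_{ij}\leq |C|-1\ \text{ for all } C\in\mathcal C_1\Big\}.$$
   Context: Let $n\ge 4$, $N=\{1,\dots,n\}$, $A=\{ij : i,j\in N,\ i\ne j\}$, $N_1=N\setminus\{1\}$, $A_1=\{ij : i,j\in N_1,\ i\neq j\}$. $\mathcal C_1$ is the set of (simple) directed cycles with arcs in $A_1$, each of length at least 2 and identified with its set of arcs; $|C|$ is the number of arcs. $P_{\mathrm{AP}}$ is the set of $x\in[0,1]^A$ with $\sum_{j\neq i}x_{ij}=1$ and $\sum_{j\ne i}x_{ji}=1$ for all $i\in N$. $D=\{d\in\mathbb R_{++}^{A_1} : \sum_{ij\in C}d_{ij}\le 1\ \text{for all } C\in\mathcal C_1\}$, where $\mathbb R_{++}$ denotes the positive reals, and $\overline D$ is the same set with $\mathbb R_{++}$ replaced by the nonnegative reals $\mathbb R_+$. For $d\in\overline D$, $P_{\mathrm{MTZ}}(d)$ is the projection onto the $x$ variables of $$Q_{\mathrm{MTZ}}(d)=\{(x,u)\in P_{\mathrm{AP}}\times\mathbb R^{N_1} : u_i-u_j+d_{ij}\le 1-x_{ij}\ \text{for all } ij\in A_1\}.$$ For $k\in N_1$, $d^k\in\mathbb R^{A_1}_+$ is the vector with $d^k_{ij}=1$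 if $i=k$ and $d^k_{ij}=0$ if $i\ne k$; $V_{\mathrm{MTZ}}=\{d^k : k\in N_1\}\subseteq\overline D$. (The paper writes $\mathbf{Cl}(P_{\mathrm{MTZ}}(D'))$ for $\bigcap_{d\in D'}P_{\mathrm{MTZ}}(d)$.) *)

theory Defs
  imports Complex_Main "HOL-Library.FuncSet" "Graph_Theory.Pair_Digraph"
begin

text \<open>
  Vectors indexed by a finite set \<open>I\<close> are extensional functions \<open>I \<rightarrow>\<^sub>E UNIV\<close> (undefined outside
  \<open>I\<close>), so that equality of vectors, and hence of sets of vectors, is the componentwise one.
\<close>

definition nodes :: "nat \<Rightarrow> nat set" where
  "nodes n = {1..n}"

definition arcs_on :: "nat set \<Rightarrow> (nat \<times> nat) set" where
  "arcs_on S = {(i, j). i \<in> S \<and> j \<in> S \<and> i \<noteq> j}"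

definition N1 :: "nat \<Rightarrow> nat set" where
  "N1 n = nodes n - {1}"

abbreviation A :: "nat \<Rightarrow> (nat \<times> nat) set" where
  "A n \<equiv> arcs_on (nodes n)"

abbreviation A1 :: "nat \<Rightarrow> (nat \<times> nat) set" where
  "A1 n \<equiv> arcs_on (N1 n)"

text \<open>
  The predicate \<open>cycle\<close> describes arc lists; passing to arc sets identifies the cyclic rotations
  of a cycle. No arc repeats in a cycle, so \<open>card\<close> of the arc set is the length.
\<close>

definition cycles1 :: "nat \<Rightarrow> (nat \<times> nat) set set" where
  "cycles1 n =
     {set p | p. pre_digraph.cycle (with_proj \<lparr>pverts = N1 n, parcs = A1 n\<rparr>) p \<and> 2 \<le> length p}"

definition P_AP :: "nat \<Rightarrow> (nat \<times> nat \<Rightarrow> real) set" where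
  "P_AP n = {x \<in> A n \<rightarrow>\<^sub>E {0..1}.
     (\<forall>i\<in>nodes n. (\<Sum>j\<in>nodes n - {i}. x (i, j)) = 1) \<and>
     (\<forall>i\<in>nodes n. (\<Sum>j\<in>nodes n - {i}. x (j, i)) = 1)}"

definition D :: "nat \<Rightarrow> (nat \<times> nat \<Rightarrow> real) set" where
  "D n = {d \<in> A1 n \<rightarrow>\<^sub>E {0<..}. \<forall>C\<in>cycles1 n. (\<Sum>a\<in>C. d a) \<le> 1}"

definition Q_MTZ ::
    "nat \<Rightarrow> (nat \<times> nat \<Rightarrow> real) \<Rightarrow> ((nat \<times> nat \<Rightarrow> real) \<times> (nat \<Rightarrow> real)) set" where
  "Q_MTZ n d = {(x, u) \<in> P_AP n \<times> (N1 n \<rightarrow>\<^sub>E UNIV).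
     \<forall>(i, j)\<in>A1 n. u i - u j + d (i, j) \<le> 1 - x (i, j)}"

definition P_MTZ :: "nat \<Rightarrow> (nat \<times> nat \<Rightarrow> real) \<Rightarrow> (nat \<times> nat \<Rightarrow> real) set" where
  "P_MTZ n d = fst ` Q_MTZ n d"

definition d_unit :: "nat \<Rightarrow> nat \<Rightarrow> nat \<times> nat \<Rightarrow> real" where
  "d_unit n k = (\<lambda>(i, j)\<in>A1 n. if i = k then 1 else 0)"

definition V_MTZ :: "nat \<Rightarrow> (nat \<times> nat \<Rightarrow> real) set" where
  "V_MTZ n = d_unit n ` N1 n"

definition P_MTZ_closure :: "nat \<Rightarrow> (nat \<times> nat \<Rightarrow> real) set" where
  "P_MTZ_closure n =
     {x \<in> P_AP n. \<forall>C\<in>cycles1 n. (\<Sum>a\<in>C. x a) \<le> real (card C) - 1}"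

end

theory Submission
  imports Defs
begin

text \<open>
  For fixed \<open>x\<close> and \<open>d\<close> the constraints on \<open>u\<close> form a system of difference constraints
  \<open>u\<^sub>i - u\<^sub>j \<le> c\<^sub>i\<^sub>j\<close> with \<open>c\<^sub>i\<^sub>j = 1 - x\<^sub>i\<^sub>j - d\<^sub>i\<^sub>j\<close>, one for each arc. Along a directed cycle the left-hand
  sides cancel, so every cycle must have nonnegative total cost; conversely, if no cycle has negative
  cost, then shortest-path distances solve the system (\<open>potential_if_no_negative_cycle\<close>). Hence
  (\<open>P_MTZ_iff\<close>) the projection is cut out of the assignment polytope by the inequalities
  \<open>x(C) \<le> |C| - d(C)\<close>, one for each cycle \<open>C\<close>.

  Intersecting over a family of vectors \<open>d\<close> therefore replaces \<open>d(C)\<close> by its supremum over the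
  family, independently for each cycle. It remains to see that this supremum is 1 for both families
  (\<open>Inter_P_MTZ_eq_closure\<close>). It is at most 1 by definition of \<open>D\<close>, respectively because a cycle leaves
  each vertex at most once. If \<open>k\<close> is a vertex of \<open>C\<close>, then \<open>d\<^sup>k(C) = 1\<close>, so the bound is attained in
  the finite family. In \<open>D\<close> it is approached by the strictly positive vectors \<open>(1 - e) d\<^sup>k + e/n\<close> as \<open>e\<close>
  tends to 0; they lie in \<open>D\<close> because a cycle has at most \<open>n\<close> arcs.
\<close>

section \<open>Potentials in digraphs without negative cycles\<close>

text \<open>
  The potential of \<open>i\<close> is the least cost of a simple path that starts at \<open>i\<close> and ends anywhere. Leaving
  the end free keeps it finite without any connectivity assumption, since the empty path always
  competes; restricting to simple paths makes the minimum range over a finite set and means that only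
  simple cycles need to be tested.
\<close>

lemma (in fin_digraph) potential_if_no_negative_cycle:
  fixes c :: "'b \<Rightarrow> real"
  assumes nonneg: "\<And>p. cycle p \<Longrightarrow> 0 \<le> sum_list (map c p)"
  obtains \<pi> :: "'a \<Rightarrow> real" where "\<And>a. a \<in> arcs G \<Longrightarrow> \<pi> (tail G a) \<le> c a + \<pi> (head G a)"
proof -
  define costs where "costs i = (\<lambda>p. sum_list (map c p)) ` {p. \<exists>v. apath i p v}" for i
  have fin: "finite (costs i)" for i
  proof -
    have "{p. \<exists>v. apath i p v} = (\<Union>v\<in>verts G. {p. apath i p v})"
      by (auto simp: apath_def intro: awalk_last_in_verts)
    then show ?thesis
      using apaths_finite by (simp add: costs_def)
  qed
  have "Min (costs (tail G a)) \<le> c a + Min (costs (head G a))" if a: "a \<in> arcs G" for a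
  proof -
    have "apath (head G a) [] (head G a)"
      using a by (simp add: apath_Nil_iff)
    then have "costs (head G a) \<noteq> {}"
      by (auto simp: costs_def)
    from Min_in[OF fin this] obtain p v where p: "apath (head G a) p v"
      and cost_p: "Min (costs (head G a)) = sum_list (map c p)"
      by (auto simp: costs_def)
    have "\<exists>q. (\<exists>w. apath (tail G a) q w) \<and> sum_list (map c q) \<le> c a + sum_list (map c p)"
    proof (cases "tail G a \<in> set (awalk_verts (head G a) p)")
      case False
      then have "apath (tail G a) (a # p) v"
        using a p by (simp add: apath_Cons_iff)
      then show ?thesis
        by (intro exI[of _ "a # p"]) auto
    next
      case True
      \<comment> \<open>The path already visits the tail of \<open>a\<close>. The part up to that visit closes \<open>a\<close> to a cycle,
         and the rest is a path from the tail.\<close>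
      then obtain q r where pqr: "p = q @ r" "awalk (head G a) q (tail G a)" "awalk (tail G a) r v"
        using p by (metis apath_def awalk_decomp)
      have "awlast (head G a) q = tail G a"
        using pqr(2) by auto
      then have "apath (head G a) q (tail G a)" and r: "apath (tail G a) r v"
        using p by (auto simp: pqr(1) apath_append_iff)
      then have "cycle (a # q)"
        using a by (auto simp: cycle_def apath_def awalk_Cons_iff)
      then have "0 \<le> c a + sum_list (map c q)"
        using nonneg by fastforce
      then show ?thesis
        using pqr(1) r by (intro exI[of _ r]) auto
    qed
    then obtain q w where q: "apath (tail G a) q w"
      and "sum_list (map c q) \<le> c a + sum_list (map c p)"
      by blast
    moreover have "Min (costs (tail G a)) \<le> sum_list (map c q)"
      using q by (intro Min_le fin) (auto simp: costs_def)
    ultimately show ?thesis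
      unfolding cost_p by linarith
  qed
  then show thesis
    using that[of "\<lambda>i. Min (costs i)"] by blast
qed

section \<open>Directed cycles as arc sets\<close>

lemma fin_digraph_arcs_on:
  "finite S \<Longrightarrow> fin_digraph (with_proj \<lparr>pverts = S, parcs = arcs_on S\<rparr>)"
  by unfold_locales (auto simp: arcs_on_def intro: finite_subset[of _ "S \<times> S"])

lemma finite_N1 [simp]: "finite (N1 n)"
  by (simp add: N1_def nodes_def)

text \<open>
  A cycle is a cyclic permutation of its vertices: each of them is the tail of exactly one arc and the
  head of exactly one arc. So a sum over the arcs of a function of the tail, or of the head, is a sum
  over the vertices.
\<close>

lemma cycles1_permutation:
  assumes "C \<in> cycles1 n"
  shows "C \<subseteq> A1 n" "C \<noteq> {}" "finite C" "inj_on fst C" "inj_on snd C" "fst ` C = snd ` C"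
proof -
  let ?G = "with_proj \<lparr>pverts = N1 n, parcs = A1 n\<rparr>"
  interpret fin_digraph ?G
    by (rule fin_digraph_arcs_on) simp
  obtain p where p: "cycle p" "2 \<le> length p" and C: "C = set p"
    using assms by (auto simp: cycles1_def)
  obtain u where u: "awalk u p u" "distinct (tl (awalk_verts u p))"
    using p by (auto simp: cycle_def)
  have ne: "p \<noteq> []"
    using p by auto
  have verts: "awalk_verts u p = fst (hd p) # map snd p"
    using u ne by (auto simp: awalk_verts_conv'[of u p u])
  have "awalk_verts u p = map fst p @ [snd (last p)]"
    using ne by (simp add: awalk_verts_conv)
  moreover have "fst (hd p) = u" "snd (last p) = u"
    using u ne verts by (auto simp: awalk_conv last_map)
  \<comment> \<open>Reading the closed walk once by tails and once by heads shows that the list of heads is the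
     list of tails rotated by one.\<close>
  ultimately have shift: "map fst p @ [u] = u # map snd p"
    using verts by simp
  from arg_cong[OF this, of mset] have mset: "mset (map fst p) = mset (map snd p)"
    by simp
  have "distinct (map snd p)"
    using u verts by simp
  then show "inj_on snd C"
    by (simp add: C distinct_map)
  show "inj_on fst C"
    using mset_eq_imp_distinct_iff[OF mset] \<open>distinct (map snd p)\<close> by (simp add: C distinct_map)
  show "fst ` C = snd ` C"
    using mset_eq_setD[OF mset] by (simp add: C)
  show "C \<subseteq> A1 n"
    using u by (auto simp: C awalk_def)
  show "C \<noteq> {}" "finite C"
    using ne by (auto simp: C)
qed

lemma sum_potential_difference_cycle:
  fixes \<pi> :: "nat \<Rightarrow> real"
  assumes "C \<in> cycles1 n"
  shows "(\<Sum>a\<in>C. \<pi> (fst a) - \<pi> (snd a)) = 0"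
proof -
  note C = cycles1_permutation[OF assms]
  have "(\<Sum>a\<in>C. \<pi> (fst a)) = (\<Sum>i\<in>fst ` C. \<pi> i)"
    by (simp add: sum.reindex[OF C(4)])
  also have "\<dots> = (\<Sum>a\<in>C. \<pi> (snd a))"
    by (simp add: C(6) sum.reindex[OF C(5)])
  finally show ?thesis
    by (simp add: sum_subtractf)
qed

lemma card_cycle_le:
  assumes "C \<in> cycles1 n"
  shows "card C \<le> n"
proof -
  note C = cycles1_permutation[OF assms]
  have "card C = card (fst ` C)"
    by (simp add: card_image C)
  also have "\<dots> \<le> card {1..n}"
    using C(1) by (intro card_mono) (auto simp: arcs_on_def N1_def nodes_def)
  finally show ?thesis
    by simp
qed

section \<open>The projection in the space of arc variables\<close>

text \<open>
  Eliminating \<open>u\<close>: summing its constraints around a cycle gives the inequality for that cycle, and the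
  cycle inequalities say that the arc costs \<open>1 - x\<^sub>a - d\<^sub>a\<close> admit no negative cycle, so that a potential
  exists and can serve as \<open>u\<close>.
\<close>

lemma P_MTZ_iff:
  "x \<in> P_MTZ n d \<longleftrightarrow>
     x \<in> P_AP n \<and> (\<forall>C\<in>cycles1 n. (\<Sum>a\<in>C. x a) + (\<Sum>a\<in>C. d a) \<le> real (card C))"
proof (intro iffI conjI ballI)
  assume "x \<in> P_MTZ n d"
  then obtain u where x: "x \<in> P_AP n"
    and u: "\<And>i j. (i, j) \<in> A1 n \<Longrightarrow> u i - u j + d (i, j) \<le> 1 - x (i, j)"
    by (fastforce simp: P_MTZ_def Q_MTZ_def)
  show "x \<in> P_AP n" by (fact x)
  fix C assume C: "C \<in> cycles1 n"
  have "(\<Sum>a\<in>C. (u (fst a) - u (snd a)) + (x a + d a)) \<le> (\<Sum>a\<in>C. 1)"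
    using cycles1_permutation(1)[OF C] u by (intro sum_mono) (force simp: algebra_simps)
  then show "(\<Sum>a\<in>C. x a) + (\<Sum>a\<in>C. d a) \<le> real (card C)"
    using sum_potential_difference_cycle[OF C, of u]
    by (simp only: sum.distrib) simp
next
  let ?G = "with_proj \<lparr>pverts = N1 n, parcs = A1 n\<rparr>"
  assume x: "x \<in> P_AP n \<and>
    (\<forall>C\<in>cycles1 n. (\<Sum>a\<in>C. x a) + (\<Sum>a\<in>C. d a) \<le> real (card C))"
  interpret fin_digraph ?G
    by (rule fin_digraph_arcs_on) simp
  interpret loopfree_digraph ?G
    by unfold_locales (auto simp: arcs_on_def)
  have "0 \<le> (\<Sum>a\<leftarrow>p. 1 - x a - d a)" if p: "cycle p" for p
  proof -
    have "distinct p"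
      using p by (auto simp: cycle_conv)
    have "2 \<le> length p"
      using p unfolding cycle_digraph_conv by blast
    then have "set p \<in> cycles1 n"
      using p by (auto simp: cycles1_def)
    then show ?thesis
      using x \<open>distinct p\<close>
      by (fastforce simp: sum_list_distinct_conv_sum_set sum_subtractf)
  qed
  then obtain \<pi> where \<pi>: "\<And>a. a \<in> A1 n \<Longrightarrow> \<pi> (fst a) \<le> 1 - x a - d a + \<pi> (snd a)"
    by (rule potential_if_no_negative_cycle) auto
  have "(x, restrict \<pi> (N1 n)) \<in> Q_MTZ n d"
    using x \<pi> by (force simp: Q_MTZ_def arcs_on_def algebra_simps)
  then show "x \<in> P_MTZ n d"
    by (force simp: P_MTZ_def)
qed

text \<open>
  The vectors that come close to 1 may depend on the cycle, because the intersection imposes the cycle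
  inequalities one at a time. Nonemptiness of \<open>S\<close> puts the intersection inside the assignment polytope.
\<close>

lemma Inter_P_MTZ_eq_closure:
  assumes "S \<noteq> {}"
    and le: "\<And>d C. d \<in> S \<Longrightarrow> C \<in> cycles1 n \<Longrightarrow> (\<Sum>a\<in>C. d a) \<le> 1"
    and approx: "\<And>C e. C \<in> cycles1 n \<Longrightarrow> 0 < e \<Longrightarrow> \<exists>d\<in>S. 1 - e \<le> (\<Sum>a\<in>C. d a)"
  shows "(\<Inter>d\<in>S. P_MTZ n d) = P_MTZ_closure n"
proof (intro equalityI subsetI)
  fix x assume x: "x \<in> (\<Inter>d\<in>S. P_MTZ n d)"
  have "(\<Sum>a\<in>C. x a) \<le> real (card C) - 1" if C: "C \<in> cycles1 n" for C
  proof (rule field_le_epsilon)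
    fix e :: real assume "0 < e"
    with approx[OF C] obtain d where "d \<in> S" "1 - e \<le> (\<Sum>a\<in>C. d a)"
      by blast
    then show "(\<Sum>a\<in>C. x a) \<le> real (card C) - 1 + e"
      using x C by (fastforce simp: P_MTZ_iff)
  qed
  then show "x \<in> P_MTZ_closure n"
    using x \<open>S \<noteq> {}\<close> by (auto simp: P_MTZ_closure_def P_MTZ_iff)
next
  fix x assume "x \<in> P_MTZ_closure n"
  then show "x \<in> (\<Inter>d\<in>S. P_MTZ n d)"
    using le by (fastforce simp: P_MTZ_closure_def P_MTZ_iff)
qed

section \<open>The two families of coefficient vectors\<close>

lemma sum_d_unit_cycle:
  assumes "C \<in> cycles1 n"
  shows "(\<Sum>a\<in>C. d_unit n k a) = of_bool (k \<in> fst ` C)"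
proof -
  note C = cycles1_permutation[OF assms]
  have "(\<Sum>a\<in>C. d_unit n k a) = (\<Sum>a\<in>C. of_bool (fst a = k))"
    using C(1) by (intro sum.cong) (auto simp: d_unit_def)
  also have "\<dots> = (\<Sum>i\<in>fst ` C. of_bool (i = k))"
    by (simp add: sum.reindex[OF C(4)])
  also have "\<dots> = of_bool (k \<in> fst ` C)"
    using C(3) by (simp add: of_bool_def sum.delta)
  finally show ?thesis .
qed

text \<open>
  The convex combination of \<open>d\<^sup>k\<close> and the constant vector \<open>1/n\<close>: the former is extremal but has zero
  entries, the latter is positive and has sum at most 1 on every cycle.
\<close>

definition d_pos :: "nat \<Rightarrow> nat \<Rightarrow> real \<Rightarrow> nat \<times> nat \<Rightarrow> real" where
  "d_pos n k e = (\<lambda>a\<in>A1 n. (1 - e) * d_unit n k a + e / n)"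

lemma sum_d_pos_cycle:
  assumes "C \<in> cycles1 n"
  shows "(\<Sum>a\<in>C. d_pos n k e a) = (1 - e) * of_bool (k \<in> fst ` C) + e * (card C / n)"
proof -
  have "(\<Sum>a\<in>C. d_pos n k e a) = (\<Sum>a\<in>C. (1 - e) * d_unit n k a + e / n)"
    using cycles1_permutation(1)[OF assms] by (intro sum.cong) (auto simp: d_pos_def)
  then show ?thesis
    by (simp add: sum.distrib sum_d_unit_cycle[OF assms] flip: sum_distrib_left)
qed

lemma d_pos_in_D:
  assumes "0 < e" "e \<le> 1" "n > 0"
  shows "d_pos n k e \<in> D n"
proof -
  have "0 < (1 - e) * d_unit n k a + e / n" if "a \<in> A1 n" for a
    using that assms by (intro add_nonneg_pos) (auto simp: d_unit_def split: prod.splits)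
  moreover have "(\<Sum>a\<in>C. d_pos n k e a) \<le> 1" if C: "C \<in> cycles1 n" for C
  proof -
    have "(1 - e) * of_bool (k \<in> fst ` C) + e * (card C / n) \<le> (1 - e) * 1 + e * 1"
      using assms card_cycle_le[OF C] by (intro add_mono mult_left_mono) auto
    then show ?thesis
      by (simp add: sum_d_pos_cycle[OF C])
  qed
  ultimately show ?thesis
    by (auto simp: D_def d_pos_def)
qed

theorem theorem17:
  fixes n :: nat
  assumes "n \<ge> 4"
  shows "(\<Inter>d\<in>D n. P_MTZ n d) = (\<Inter>d\<in>V_MTZ n. P_MTZ n d)
       \<and> (\<Inter>d\<in>V_MTZ n. P_MTZ n d) = P_MTZ_closure n"
proof -
  have tail: "\<exists>k. k \<in> N1 n \<and> k \<in> fst ` C" if C: "C \<in> cycles1 n" for C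
  proof -
    obtain a where "a \<in> C"
      using cycles1_permutation(2)[OF C] by blast
    moreover have "fst a \<in> N1 n"
      using cycles1_permutation(1)[OF C] \<open>a \<in> C\<close> by (auto simp: arcs_on_def)
    ultimately show ?thesis
      by blast
  qed
  have "(\<Inter>d\<in>V_MTZ n. P_MTZ n d) = P_MTZ_closure n"
  proof (rule Inter_P_MTZ_eq_closure)
    show "V_MTZ n \<noteq> {}"
    proof -
      have "2 \<in> N1 n"
        using assms by (simp add: N1_def nodes_def)
      then show ?thesis
        by (auto simp: V_MTZ_def)
    qed
    show "(\<Sum>a\<in>C. d a) \<le> 1" if "d \<in> V_MTZ n" "C \<in> cycles1 n" for d C
      using that by (auto simp: V_MTZ_def sum_d_unit_cycle)
    show "\<exists>d\<in>V_MTZ n. 1 - e \<le> (\<Sum>a\<in>C. d a)" if "C \<in> cycles1 n" "0 < e" for C and e :: real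
      using tail[OF that(1)] that by (auto simp: V_MTZ_def sum_d_unit_cycle)
  qed
  moreover have "(\<Inter>d\<in>D n. P_MTZ n d) = P_MTZ_closure n"
  proof (rule Inter_P_MTZ_eq_closure)
    show "D n \<noteq> {}"
      using d_pos_in_D[of 1 n] assms by auto
    show "(\<Sum>a\<in>C. d a) \<le> 1" if "d \<in> D n" "C \<in> cycles1 n" for d C
      using that by (auto simp: D_def)
    show "\<exists>d\<in>D n. 1 - e \<le> (\<Sum>a\<in>C. d a)" if C: "C \<in> cycles1 n" and "0 < e" for C and e :: real
    proof -
      obtain k where k: "k \<in> fst ` C"
        using tail[OF C] by blast
      \<comment> \<open>Capping at 1 keeps the combination convex.\<close>
      define e' where "e' = min e 1"
      have e': "0 < e'" "e' \<le> 1" "e' \<le> e"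
        using \<open>0 < e\<close> by (auto simp: e'_def)
      have "0 \<le> e' * (card C / n)"
        using e' by simp
      then have "1 - e \<le> (\<Sum>a\<in>C. d_pos n k e' a)"
        using k e'(3) by (simp add: sum_d_pos_cycle[OF C] del: times_divide_eq_right)
      moreover have "d_pos n k e' \<in> D n"
        using e' assms by (intro d_pos_in_D) auto
      ultimately show ?thesis
        by blast
    qed
  qed
  ultimately show ?thesis
    by simp
qed

end
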